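(* For every integer $m\ge 1$ and all $n$ sufficiently large in terms of $m$, under the optimal misère strategy with Yes/No feedback, $$1-e^{-m}-o(1)\le \mathbb{E}[S_{m,n}]\le m-1+m^{-1}-m^{-1}e^{-m}+o(1),$$ i.e. these inequalities hold with $\mathbb{E}[S_{m,n}]=\min_{\mathcal{G}}\mathbb{E}[S(\mathcal{G},\boldsymbol{\pi})]$, the minimum being over all strategies $\mathcal{G}$ with Yes/No feedback, where $o(1)$ denotes quantities tending to $0$ as $n\to\infty$ with $m$ fixed.
   Context: Let $[n]=\{1,\dots,n\}$ and let $\mathfrak{S}_{m,n}$ be the set of all words $\pi=\pi_1\pi_2\cdots\pi_{mn}$ containing exactly $m$ copies of each element of $[n]$ (a shuffled deck of $mn$ cards with $n$ card types, each of multiplicity $m$). Let $\boldsymbol{\pi}$ be a uniformly random element of $\mathfrak{S}_{m,n}$. In the Yes/No feedback game, at each time $t=1,\dots,mn$ the player guesses the value of $\pi_t$ by naming an element of $[n]$, and is then told only whether the guess was correct or not. A strategy $\mathcal{G}$ with Yes/No feedback is a rule determining each guess from the feedback received so far, i.e. a sequence of functions $g_t:\{0,1\}^{t-1}\to[n]$, $1\le t\le mn$, where the guess at time $t$ is $g_t(x_1,\dots,x_{t-1})$ and $x_s=1$ if the $s$th guess was correct and $x_s=0$ otherwise. $S(\mathcal{G},\pi)$ is the total number of correct guesses when strategy $\mathcal{G}$ is used on $\pi$, and $S_{m,n}=S(\mathcal{G},\boldsymbol{\pi})$ for the strategy in question. An optimal misère strategy is one attaining $\min_{\mathcal{G}}\mathbb{E}[S(\mathcal{G},\boldsymbol{\pi})]$.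 *)

theory Defs
  imports "HOL-Probability.Probability"
begin

definition decks :: "nat \<Rightarrow> nat \<Rightarrow> nat list set" where
  "decks m n = {\<pi>. set \<pi> \<subseteq> {1..n} \<and> (\<forall>i\<in>{1..n}. count_list \<pi> i = m)}"

text \<open>The history \<open>[x\<^sub>1, \<dots>, x\<^bsub>t-1\<^esub>]\<close> determines \<open>t\<close>, so the sequence \<open>g\<^sub>1, \<dots>, g\<^bsub>mn\<^esub>\<close> is
  represented by a single function on histories of length less than \<open>m * n\<close> (and \<open>undefined\<close>
  elsewhere).\<close>

definition strategies :: "nat \<Rightarrow> nat \<Rightarrow> (bool list \<Rightarrow> nat) set" where
  "strategies m n = {xs. length xs < m * n} \<rightarrow>\<^sub>E {1..n}"

text \<open>The feedback of the first \<open>t\<close> rounds, in chronological order. List positions count from 0,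
  so round \<open>Suc t\<close> concerns the card \<open>\<pi> ! t\<close>.\<close>

primrec feedback :: "(bool list \<Rightarrow> nat) \<Rightarrow> nat list \<Rightarrow> nat \<Rightarrow> bool list" where
  "feedback G \<pi> 0 = []"
| "feedback G \<pi> (Suc t) = feedback G \<pi> t @ [G (feedback G \<pi> t) = \<pi> ! t]"

definition score :: "(bool list \<Rightarrow> nat) \<Rightarrow> nat list \<Rightarrow> nat" where
  "score G \<pi> = count_list (feedback G \<pi> (length \<pi>)) True"

definition expected_score :: "nat \<Rightarrow> nat \<Rightarrow> (bool list \<Rightarrow> nat) \<Rightarrow> real" where
  "expected_score m n G =
     measure_pmf.expectation (pmf_of_set (decks m n)) (\<lambda>\<pi>. real (score G \<pi>))"

definition misere_value :: "nat \<Rightarrow> nat \<Rightarrow> real" where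
  "misere_value m n = Min (expected_score m n ` strategies m n)"

text \<open>\<open>pmf_of_set\<close> and \<open>Min\<close> are only meaningful on finite nonempty sets.\<close>

lemma length_decks:
  assumes "\<pi> \<in> decks m n"
  shows "length \<pi> = m * n"
proof -
  have "length \<pi> = (\<Sum>i\<in>{1..n}. count_list \<pi> i)"
    using assms sum_count_set[of \<pi> "{1..n}"] by (auto simp: decks_def)
  also have "\<dots> = m * n"
    using assms by (simp add: decks_def)
  finally show ?thesis .
qed

lemma finite_decks: "finite (decks m n)"
proof (rule finite_subset)
  show "decks m n \<subseteq> {\<pi>. set \<pi> \<subseteq> {1..n} \<and> length \<pi> = m * n}"
    using length_decks by (auto simp: decks_def)
qed (simp add: finite_lists_length_eq)

lemma decks_nonempty: "decks m n \<noteq> {}"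
proof -
  have c: "count_list (replicate m k) i = (if i = k then m else 0)" for i k :: nat
    by (induction m) auto
  have "\<exists>\<pi>. \<pi> \<in> decks m n"
  proof (induction n)
    case 0
    show ?case by (intro exI[of _ "[]"]) (simp add: decks_def)
  next
    case (Suc n)
    then obtain \<pi> where p: "\<pi> \<in> decks m n" by blast
    have "Suc n \<notin> set \<pi>" using p by (auto simp: decks_def)
    hence "count_list \<pi> (Suc n) = 0" by (simp add: count_list_0_iff)
    hence "\<pi> @ replicate m (Suc n) \<in> decks m (Suc n)"
      using p by (auto simp: decks_def c le_Suc_eq)
    thus ?case by blast
  qed
  thus ?thesis by blast
qed

lemma finite_strategies: "finite (strategies m n)"
proof -
  have "{xs :: bool list. length xs < m * n} \<subseteq> {xs. set xs \<subseteq> UNIV \<and> length xs \<le> m * n}"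
    by auto
  hence "finite {xs :: bool list. length xs < m * n}"
    using finite_lists_length_le[of "UNIV :: bool set" "m * n"] finite_subset by auto
  thus ?thesis
    unfolding strategies_def by (intro finite_PiE) auto
qed

lemma strategies_nonempty: "n \<ge> 1 \<Longrightarrow> strategies m n \<noteq> {}"
  by (auto simp: strategies_def PiE_eq_empty_iff)

end

theory Submission imports Defs "HOL-Real_Asymp.Real_Asymp" begin

text \<open>Until its first correct guess a strategy only follows a fixed word \<open>g\<close>, so everything depends
  on the fraction \<open>q\<^sub>t\<close> of decks that avoid the first \<open>t\<close> letters of \<open>g\<close>. Comparing the decks that
  are hit for the first time at \<open>t\<close> with those avoiding \<open>g\<close> up to \<open>t\<close>, by transposing position \<open>t\<close>
  with another one, gives \<open>q\<^bsub>t+1\<^esub> \<le> (1 - 1/n) q\<^sub>t + O(1/n\<^sup>2)\<close> for every word \<open>g\<close>. Hence any strategy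
  scores at least once with probability at least \<open>1 - (1 - 1/n)\<^bsup>mn\<^esup> - O(1/n)\<close>, the lower bound.

  For the upper bound, guess each card type \<open>m\<close> times in a row until a guess is correct, and repeat
  that guess forever. The same transpositions give \<open>q\<^bsub>t+1\<^esub> \<ge> (1 - 1/(n-1)) q\<^sub>t\<close> and show that after a
  first hit at \<open>t\<close> each later position is hit again with probability at most \<open>(m-1)/(mn-m)\<close>.
  Summing by parts over \<open>t\<close> gives the bound.\<close>

section \<open>Counting by transpositions\<close>

definition swap_nth :: "'a list \<Rightarrow> nat \<Rightarrow> nat \<Rightarrow> 'a list" where
  "swap_nth xs p q = xs[p := xs ! q, q := xs ! p]"

lemma length_swap_nth [simp]: "length (swap_nth xs p q) = length xs"
  by (simp add: swap_nth_def)

lemma nth_swap_nth: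
  assumes "p < length xs" "q < length xs"
  shows "swap_nth xs p q ! r = (if r = q then xs ! p else if r = p then xs ! q else xs ! r)"
  using assms by (auto simp: swap_nth_def nth_list_update)

lemma swap_nth_swap_nth:
  assumes "p < length xs" "q < length xs"
  shows "swap_nth (swap_nth xs p q) p q = xs"
  using assms by (intro nth_equalityI) (auto simp: nth_swap_nth)

lemma mset_swap_nth:
  assumes "p < length xs" "q < length xs"
  shows "mset (swap_nth xs p q) = mset xs"
  using mset_swap[OF assms(2,1)] by (simp add: swap_nth_def)

lemma swap_nth_in_decks:
  assumes "\<pi> \<in> decks m n" "p < m * n" "q < m * n"
  shows "swap_nth \<pi> p q \<in> decks m n"
proof -
  have "mset (swap_nth \<pi> p q) = mset \<pi>"
    using assms length_decks[OF assms(1)] by (intro mset_swap_nth) auto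
  hence "set (swap_nth \<pi> p q) = set \<pi>" "count_list (swap_nth \<pi> p q) = count_list \<pi>"
    by (auto dest: mset_eq_setD simp flip: count_mset)
  thus ?thesis using assms(1) by (simp add: decks_def)
qed

lemma card_positions_decks:
  assumes "\<pi> \<in> decks m n" "i \<in> {1..n}"
  shows "card {q. q < m * n \<and> \<pi> ! q = i} = m"
proof -
  have "count_list \<pi> i = card {q. q < length \<pi> \<and> \<pi> ! q = i}"
    by (simp add: count_list_eq_length_filter length_filter_conv_card eq_commute)
  thus ?thesis using assms length_decks[OF assms(1)] by (auto simp: decks_def)
qed

text \<open>Double counting: transposing \<open>p\<close> and \<open>q\<close> turns a pair (\<pi>,
  q) with \<open>i\<close> at \<open>p\<close> into one with \<open>i\<close> at \<open>q\<close>.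
  Recording \<open>q\<close> makes the map its own inverse, hence injective, and each member of
  \<open>S\<close> is met by at most \<open>k\<close> values of \<open>q\<close>. \<open>Q\<close>
  is meant to hold positions to which \<open>i\<close> can be moved without leaving
  \<open>S\<close>.\<close>

lemma card_swap_le:
  assumes "finite S" "finite Q" "\<And>\<pi>. \<pi> \<in> S \<Longrightarrow> length \<pi> = N" "p < N" "Q \<subseteq> {..<N}"
    and closed: "\<And>\<pi> q. \<pi> \<in> S \<Longrightarrow> \<pi> ! p = i \<Longrightarrow> q \<in> Q \<Longrightarrow> swap_nth \<pi> p q \<in> S"
    and few: "\<And>\<pi>. \<pi> \<in> S \<Longrightarrow> card {q \<in> Q. \<pi> ! q = i} \<le> k"
  shows "card {\<pi> \<in> S. \<pi> ! p = i} * card Q \<le> k * card S"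
proof -
  let ?X = "{\<pi> \<in> S. \<pi> ! p = i} \<times> Q" and ?Y = "SIGMA \<pi>:S. {q \<in> Q. \<pi> ! q = i}"
  let ?f = "\<lambda>(\<pi>, q). (swap_nth \<pi> p q, q)"
  have "inj_on ?f ?X"
    by (rule inj_on_inverseI[of _ ?f]) (use assms in \<open>auto simp: swap_nth_swap_nth\<close>)
  moreover have "?f ` ?X \<subseteq> ?Y"
    using assms by (auto simp: nth_swap_nth)
  moreover have "finite ?Y" using assms by auto
  ultimately have "card ?X \<le> card ?Y" by (rule card_inj_on_le)
  also have "card ?Y = (\<Sum>\<pi>\<in>S. card {q \<in> Q. \<pi> ! q = i})"
    using assms by (intro card_SigmaI) auto
  also have "\<dots> \<le> k * card S"
    using sum_bounded_above[of S "\<lambda>\<pi>. card {q \<in> Q. \<pi> ! q = i}" k] few by (simp add: mult.commute)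
  finally show ?thesis by (simp add: card_cartesian_product)
qed

lemma card_positions_subset_decks:
  assumes "\<pi> \<in> decks m n" "i \<in> {1..n}" "Q \<subseteq> {..<m * n}"
  shows "card {q \<in> Q. \<pi> ! q = i} \<le> m"
proof -
  have "card {q \<in> Q. \<pi> ! q = i} \<le> card {q. q < m * n \<and> \<pi> ! q = i}"
    using assms(3) by (intro card_mono) auto
  thus ?thesis using card_positions_decks[OF assms(1,2)] by simp
qed

text \<open>Two applications of \<open>card_swap_le\<close>: first the letter at \<open>t\<close> is
  moved over all positions, then the letter at \<open>p\<close> over all positions but
  \<open>t\<close>, so that the letter already fixed at \<open>t\<close> survives.\<close>

lemma card_decks_two_values_le:
  assumes "i \<in> {1..n}" "j \<in> {1..n}" "p < m * n" "t < m * n" "p \<noteq> t"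
  shows "card {\<pi> \<in> decks m n. \<pi> ! t = j \<and> \<pi> ! p = i} * (m * n - 1) * (m * n) \<le> m\<^sup>2 * card (decks m n)"
proof -
  let ?Y = "{\<pi> \<in> decks m n. \<pi> ! t = j}"
  have 1: "card ?Y * card {..<m * n} \<le> m * card (decks m n)"
    by (rule card_swap_le[where N = "m * n"])
       (use assms in \<open>auto simp: finite_decks length_decks swap_nth_in_decks
          card_positions_decks\<close>)
  have "card {\<pi> \<in> ?Y. \<pi> ! p = i} * card ({..<m * n} - {t}) \<le> m * card ?Y"
  proof (rule card_swap_le[where N = "m * n"])
    show "card {q \<in> {..<m * n} - {t}. \<pi> ! q = i} \<le> m" if "\<pi> \<in> ?Y" for \<pi>
      using that assms by (intro card_positions_subset_decks) auto
  qed (use assms in \<open>auto simp: finite_decks length_decks swap_nth_in_decks nth_swap_nth\<close>)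
  hence "card {\<pi> \<in> ?Y. \<pi> ! p = i} * (m * n - 1) \<le> m * card ?Y"
    using assms by simp
  hence "card {\<pi> \<in> ?Y. \<pi> ! p = i} * (m * n - 1) * (m * n) \<le> m * card ?Y * (m * n)"
    by (rule mult_le_mono1)
  also have "\<dots> \<le> m * (m * card (decks m n))"
    using mult_le_mono2[OF 1, of m] by (simp add: ac_simps)
  finally show ?thesis by (simp add: power2_eq_square ac_simps conj_ac)
qed

section \<open>Decks avoiding a word\<close>

definition avoiding :: "nat \<Rightarrow> nat \<Rightarrow> (nat \<Rightarrow> nat) \<Rightarrow> nat \<Rightarrow> nat list set" where
  "avoiding m n g t = {\<pi> \<in> decks m n. \<forall>s<t. \<pi> ! s \<noteq> g s}"

definition first_hit :: "nat \<Rightarrow> nat \<Rightarrow> (nat \<Rightarrow> nat) \<Rightarrow> nat \<Rightarrow> nat list set" where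
  "first_hit m n g t = {\<pi> \<in> avoiding m n g t. \<pi> ! t = g t}"

lemma avoiding_decks: "\<pi> \<in> avoiding m n g t \<Longrightarrow> \<pi> \<in> decks m n"
  by (simp add: avoiding_def)

lemma finite_avoiding [simp]: "finite (avoiding m n g t)"
  by (simp add: avoiding_def finite_decks)

lemma finite_first_hit [simp]: "finite (first_hit m n g t)"
  by (simp add: first_hit_def)

lemma avoiding_Suc: "avoiding m n g (Suc t) \<union> first_hit m n g t = avoiding m n g t"
  by (auto simp: avoiding_def first_hit_def less_Suc_eq)

lemma avoiding_first_hit_disjoint: "avoiding m n g (Suc t) \<inter> first_hit m n g t = {}"
  by (auto simp: avoiding_def first_hit_def)

lemma card_avoiding_Suc:
  "card (avoiding m n g (Suc t)) + card (first_hit m n g t) = card (avoiding m n g t)"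
  using card_Un_disjoint[OF _ _ avoiding_first_hit_disjoint[of m n g t]] by (simp add: avoiding_Suc)

text \<open>Counts the exceptional pairs of the transposition argument below. Each position
  \<open>p\<close> contributes a fraction of order \<open>1 / n\<^sup>2\<close>, and there are fewer
  than \<open>m * n\<close> positions, which cancels one of the two factors from
  \<open>card_decks_two_values_le\<close>.\<close>

lemma card_bad_swaps_le:
  assumes "\<And>s. s < m * n \<Longrightarrow> g s \<in> {1..n}" "t < m * n"
  shows "card (SIGMA p:{..<t}. {\<pi> \<in> decks m n. \<pi> ! t = g p \<and> \<pi> ! p = g t}) * (m * n - 1)
    \<le> m\<^sup>2 * card (decks m n)"
proof -
  let ?N = "m * n"
  let ?B = "\<lambda>p. {\<pi> \<in> decks m n. \<pi> ! t = g p \<and> \<pi> ! p = g t}"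
  have "card (Sigma {..<t} ?B) = (\<Sum>p<t. card (?B p))"
    by (intro card_SigmaI) (auto simp: finite_decks)
  hence "card (Sigma {..<t} ?B) * (?N - 1) * ?N = (\<Sum>p<t. card (?B p) * (?N - 1) * ?N)"
    by (simp add: sum_distrib_right)
  also have "\<dots> \<le> (\<Sum>p<t. m\<^sup>2 * card (decks m n))"
    using assms by (intro sum_mono card_decks_two_values_le) auto
  also have "\<dots> \<le> (m\<^sup>2 * card (decks m n)) * ?N"
    using assms(2) by (simp add: mult.commute)
  finally show ?thesis using assms(2) by (simp only: mult_le_cancel2)
qed

text \<open>Move a copy of \<open>g t\<close> from its position \<open>q\<close> to position \<open>t\<close>. The result still avoids the first
  \<open>t\<close> letters of \<open>g\<close> unless \<open>q < t\<close> and the card arriving at \<open>q\<close> is \<open>g q\<close>, which is a rare event.\<close>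

lemma card_avoiding_le_first_hit:
  assumes "\<And>s. s < m * n \<Longrightarrow> g s \<in> {1..n}" "t < m * n"
  shows "m * card (avoiding m n g t) \<le> m * n * card (first_hit m n g t)
    + card (SIGMA p:{..<t}. {\<pi> \<in> decks m n. \<pi> ! t = g p \<and> \<pi> ! p = g t})"
proof -
  let ?N = "m * n" and ?i = "g t"
  let ?bad = "SIGMA p:{..<t}. {\<pi> \<in> decks m n. \<pi> ! t = g p \<and> \<pi> ! p = g t}"
  let ?X = "SIGMA \<pi>:avoiding m n g t. {q. q < ?N \<and> \<pi> ! q = ?i}"
  let ?f = "\<lambda>(\<pi>, q). (swap_nth \<pi> t q, q)"
  \<comment> \<open>\<open>?bad\<close> lists the position first, which suits the count by
    positions; \<open>bad'\<close> is the same set with the deck first, to match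
    \<open>?X\<close>.\<close>
  define bad' where "bad' = prod.swap ` ?bad"
  have len: "length \<pi> = ?N" if "\<pi> \<in> avoiding m n g t" for \<pi>
    using that avoiding_decks length_decks by blast
  have fin: "finite ?bad" by (auto simp: finite_decks)
  have "card ?X = (\<Sum>\<pi>\<in>avoiding m n g t. card {q. q < ?N \<and> \<pi> ! q = ?i})"
    by (intro card_SigmaI) auto
  also have "\<dots> = (\<Sum>\<pi>\<in>avoiding m n g t. m)"
    using assms by (intro sum.cong refl card_positions_decks) (auto simp: avoiding_decks)
  finally have X: "card ?X = m * card (avoiding m n g t)" by simp
  have "inj_on ?f (?X - bad')"
    by (rule inj_on_inverseI[of _ ?f])
       (use assms len in \<open>auto simp: swap_nth_swap_nth\<close>)
  moreover have "?f ` (?X - bad') \<subseteq> first_hit m n g t \<times> {..<?N}"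
  proof (clarify, intro conjI SigmaI)
    fix \<pi> q assume *: "\<pi> \<in> avoiding m n g t" "q < ?N" "\<pi> ! q = g t" "(\<pi>, q) \<notin> bad'"
    have D: "\<pi> \<in> decks m n" "length \<pi> = ?N" using * by (auto simp: avoiding_decks length_decks)
    \<comment> \<open>This rules out the only way the transposition can create an early hit: a card
      arriving at \<open>q < t\<close> that equals \<open>g q\<close>.\<close>
    have "\<not> (q < t \<and> \<pi> ! t = g q)"
      using *(3,4) D by (force simp: bad'_def image_iff)
    thus "swap_nth \<pi> t q \<in> first_hit m n g t"
      using * D assms
      by (auto simp: first_hit_def avoiding_def swap_nth_in_decks nth_swap_nth)
  qed simp
  ultimately have "card (?X - bad') \<le> card (first_hit m n g t \<times> {..<?N})"
    by (rule card_inj_on_le) simp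
  moreover have "card ?X \<le> card (?X - bad') + card bad'"
    using diff_card_le_card_Diff[of bad' ?X] fin by (simp add: bad'_def)
  moreover have "card bad' = card ?bad" unfolding bad'_def by (intro card_image) simp
  ultimately show ?thesis using X by (simp add: card_cartesian_product mult.commute)
qed

text \<open>One step of the recursion multiplies the avoiding fraction by \<open>1 - 1 / n\<close>
  and adds at most \<open>e\<close>, which is the bound on the fraction of bad swaps divided by
  \<open>m * n\<close>.\<close>

lemma card_avoiding_upper:
  fixes g :: "nat \<Rightarrow> nat"
  assumes g: "\<And>s. s < m * n \<Longrightarrow> g s \<in> {1..n}" and N: "m * n > 1" and t: "t \<le> m * n"
  defines "e \<equiv> real m / (real n * (real (m * n) - 1))"
  shows "card (avoiding m n g t) / card (decks m n) \<le> (1 - 1 / n) ^ t + t * e"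
  using t
proof (induction t)
  case 0
  show ?case by (simp add: avoiding_def)
next
  case (Suc t)
  define D where "D = real (card (decks m n))"
  define A where "A = real (card (avoiding m n g t))"
  define A' where "A' = real (card (avoiding m n g (Suc t)))"
  define H where "H = real (card (first_hit m n g t))"
  define B where "B = real (card (SIGMA p:{..<t}. {\<pi> \<in> decks m n. \<pi> ! t = g p \<and> \<pi> ! p = g t}))"
  have mn: "m > 0" "n > 0" using N by (auto intro: Nat.gr0I)
  have D: "D > 0" by (simp add: D_def card_gt_0_iff finite_decks decks_nonempty)
  have "real (m * n) \<ge> 1" using N by linarith
  hence e: "e \<ge> 0" unfolding e_def by (intro divide_nonneg_nonneg mult_nonneg_nonneg) auto
  have t': "t < m * n" using Suc.prems by simp
  have "A' + H = A"
    unfolding A_def A'_def H_def using card_avoiding_Suc[of m n g t] by linarith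
  have "real (m * card (avoiding m n g t)) \<le> real (m * n * card (first_hit m n g t)
    + card (SIGMA p:{..<t}. {\<pi> \<in> decks m n. \<pi> ! t = g p \<and> \<pi> ! p = g t}))"
    using card_avoiding_le_first_hit[of m n g, OF g t'] by (simp only: of_nat_le_iff)
  hence 1: "m * A \<le> m * n * H + B" by (simp add: A_def H_def B_def)
  have "real (card (SIGMA p:{..<t}. {\<pi> \<in> decks m n. \<pi> ! t = g p \<and> \<pi> ! p = g t}) * (m * n - 1))
    \<le> real (m\<^sup>2 * card (decks m n))"
    using card_bad_swaps_le[of m n g, OF g t'] by (simp only: of_nat_le_iff)
  hence "B * (real (m * n) - 1) \<le> real m ^ 2 * D"
    unfolding B_def D_def of_nat_mult[of _ "m * n - 1"] using N mn by (subst (asm) of_nat_diff) auto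
  hence "B \<le> real m ^ 2 * D / (real (m * n) - 1)"
    using N by (simp add: pos_le_divide_eq del: of_nat_mult)
  also have "\<dots> = m * n * (e * D)"
    using mn by (simp add: e_def power2_eq_square)
  finally have "m * A \<le> m * (n * H + n * (e * D))" using 1 by (simp add: algebra_simps)
  hence "A \<le> n * H + n * (e * D)" using mn by simp
  hence "A / n \<le> H + e * D" using mn by (simp add: field_simps)
  hence "A' \<le> (1 - 1 / n) * A + e * D" using \<open>A' + H = A\<close> by (simp add: algebra_simps)
  hence "A' / D \<le> ((1 - 1 / n) * A + e * D) / D" using D by (intro divide_right_mono) auto
  also have "\<dots> = (1 - 1 / n) * (A / D) + e" using D by (simp add: field_simps)
  also have "\<dots> \<le> (1 - 1 / n) * ((1 - 1 / n) ^ t + t * e) + e"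
    using Suc mn by (intro add_right_mono mult_left_mono) (auto simp: A_def D_def)
  also have "\<dots> = (1 - 1 / n) ^ Suc t + (1 - 1 / n) * (t * e) + e" by (simp add: algebra_simps)
  \<comment> \<open>The contraction of the earlier errors is given away, so that they simply add up
    to \<open>t * e\<close>.\<close>
  also have "\<dots> \<le> (1 - 1 / n) ^ Suc t + 1 * (t * e) + e"
    using e by (intro add_mono mult_right_mono) auto
  finally show ?case by (simp add: A'_def D_def algebra_simps)
qed

section \<open>Scores\<close>

lemma length_feedback [simp]: "length (feedback G \<pi> t) = t"
  by (induction t) auto

lemma nth_feedback: "s < t \<Longrightarrow> feedback G \<pi> t ! s \<longleftrightarrow> G (feedback G \<pi> s) = \<pi> ! s"
  by (induction t) (auto simp: nth_append less_Suc_eq)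

lemma score_eq_card: "score G \<pi> = card {s. s < length \<pi> \<and> G (feedback G \<pi> s) = \<pi> ! s}"
proof -
  have "score G \<pi> = card {s. s < length \<pi> \<and> feedback G \<pi> (length \<pi>) ! s}"
    by (simp add: score_def count_list_eq_length_filter length_filter_conv_card)
  thus ?thesis by (simp add: nth_feedback cong: conj_cong)
qed

text \<open>Reduces a strategy to the word \<open>G (replicate s False)\<close> up to its first
  correct guess.\<close>

lemma feedback_eq_replicate_False:
  assumes "\<And>s. s < t \<Longrightarrow> \<pi> ! s \<noteq> G (replicate s False)"
  shows "feedback G \<pi> t = replicate t False"
  using assms
proof (induction t)
  case (Suc t)
  hence "feedback G \<pi> t = replicate t False" "\<pi> ! t \<noteq> G (replicate t False)" by auto
  hence "feedback G \<pi> (Suc t) = replicate t False @ [False]" by simp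
  thus ?case by (simp only: replicate_append_same replicate_Suc)
qed simp

lemma expected_score_eq_sum:
  "expected_score m n G = (\<Sum>\<pi>\<in>decks m n. real (score G \<pi>)) / card (decks m n)"
  unfolding expected_score_def
  by (subst integral_pmf_of_set) (auto simp: decks_nonempty finite_decks)

lemma ex_first_hit:
  assumes "\<pi> \<in> decks m n" "\<pi> \<notin> avoiding m n g T"
  shows "\<exists>t<T. \<pi> \<in> first_hit m n g t"
proof -
  define t where "t = (LEAST t. \<pi> ! t = g t)"
  obtain s where s: "s < T" "\<pi> ! s = g s" using assms by (auto simp: avoiding_def)
  have "\<pi> ! t = g t" "t \<le> s" unfolding t_def using s(2) by (rule LeastI, rule Least_le)
  moreover have "\<pi> ! r \<noteq> g r" if "r < t" for r
    using that not_less_Least unfolding t_def by blast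
  ultimately show ?thesis
    using assms(1) s(1) by (intro exI[of _ t]) (auto simp: first_hit_def avoiding_def)
qed

lemma score_pos_if_not_avoiding:
  assumes "\<pi> \<in> decks m n" "\<pi> \<notin> avoiding m n (\<lambda>s. G (replicate s False)) (m * n)"
  shows "score G \<pi> \<ge> 1"
proof -
  obtain t where t: "t < m * n" "\<pi> \<in> first_hit m n (\<lambda>s. G (replicate s False)) t"
    using ex_first_hit[OF assms] by blast
  have "feedback G \<pi> t = replicate t False"
    using t(2) by (intro feedback_eq_replicate_False) (auto simp: first_hit_def avoiding_def)
  hence "t \<in> {s. s < length \<pi> \<and> G (feedback G \<pi> s) = \<pi> ! s}"
    using t length_decks[OF assms(1)] by (auto simp: first_hit_def)
  hence "card {s. s < length \<pi> \<and> G (feedback G \<pi> s) = \<pi> ! s} > 0"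
    by (subst card_gt_0_iff) auto
  thus ?thesis by (simp add: score_eq_card)
qed

text \<open>The mean is at least the probability of a positive score, and a zero score forces the
  deck to avoid the whole word of the strategy. At \<open>t = m * n\<close> the accumulated error
  \<open>t * e\<close> equals the last summand.\<close>

lemma expected_score_ge:
  assumes "G \<in> strategies m n" "m * n > 1"
  shows "expected_score m n G
    \<ge> 1 - ((1 - 1 / n) ^ (m * n) + real m ^ 2 / (real (m * n) - 1))"
proof -
  define g where "g = (\<lambda>s. G (replicate s False))"
  have mn: "m > 0" "n > 0" using assms by (auto intro: Nat.gr0I)
  have g: "g s \<in> {1..n}" if "s < m * n" for s
    using assms(1) that by (auto simp: g_def strategies_def PiE_def Pi_def)
  let ?D = "decks m n" and ?A = "avoiding m n g (m * n)"
  have D: "card ?D > 0" by (simp add: card_gt_0_iff finite_decks decks_nonempty)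
  have sub: "?A \<subseteq> ?D" by (auto simp: avoiding_def)
  have "real (card ?D) - card ?A = card (?D - ?A)"
    using sub by (simp add: card_Diff_subset of_nat_diff card_mono finite_decks)
  also have "\<dots> = (\<Sum>\<pi>\<in>?D - ?A. 1)" by simp
  also have "\<dots> \<le> (\<Sum>\<pi>\<in>?D - ?A. real (score G \<pi>))"
    using score_pos_if_not_avoiding[of _ m n G] by (intro sum_mono) (force simp: g_def)
  also have "\<dots> \<le> (\<Sum>\<pi>\<in>?D. real (score G \<pi>))"
    by (intro sum_mono2) (auto simp: finite_decks)
  finally have "(real (card ?D) - card ?A) / card ?D \<le> expected_score m n G"
    unfolding expected_score_eq_sum by (intro divide_right_mono) auto
  hence "1 - card ?A / card ?D \<le> expected_score m n G"
    using D by (simp add: diff_divide_distrib)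
  moreover have "card ?A / card ?D \<le> (1 - 1 / n) ^ (m * n)
      + (m * n) * (real m / (real n * (real (m * n) - 1)))"
    using card_avoiding_upper[of m n g "m * n"] g assms(2) by simp
  moreover have "(m * n) * (real m / (real n * (real (m * n) - 1))) = real m ^ 2 / (real (m * n) - 1)"
    using mn by (simp add: power2_eq_square)
  ultimately show ?thesis by linarith
qed

section \<open>The strategy that repeats its first correct guess\<close>

text \<open>On a history without a correct guess this is the length of the history, that is, the
  current time counted from 0; afterwards it is frozen at the time of the first hit. One formula
  thus covers both phases of the strategy.\<close>

definition first_True :: "bool list \<Rightarrow> nat" where
  "first_True xs = length (takeWhile Not xs)"

text \<open>Division by \<open>m\<close> assigns each card type \<open>m\<close> consecutive rounds.
  The \<open>restrict\<close> yields the extensional function that \<open>strategies\<close>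
  demands.\<close>

definition block_strategy :: "nat \<Rightarrow> nat \<Rightarrow> bool list \<Rightarrow> nat" where
  "block_strategy m n = restrict (\<lambda>xs. Suc (first_True xs div m)) {xs. length xs < m * n}"

abbreviation block_guess :: "nat \<Rightarrow> nat \<Rightarrow> nat" where
  "block_guess m t \<equiv> Suc (t div m)"

lemma block_guess_in_range:
  "t < m * n \<Longrightarrow> block_guess m t \<in> {1..n}"
  by (simp add: less_mult_imp_div_less Suc_le_eq mult.commute)

lemma block_strategy_in_strategies: "block_strategy m n \<in> strategies m n"
  unfolding block_strategy_def strategies_def
proof (rule restrict_PiE_iff[THEN iffD2], intro ballI)
  fix xs :: "bool list" assume "xs \<in> {xs. length xs < m * n}"
  hence "first_True xs < m * n"
    using length_takeWhile_le[of Not xs] by (simp add: first_True_def)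
  thus "block_guess m (first_True xs) \<in> {1..n}" by (rule block_guess_in_range)
qed

lemma first_True_replicate [simp]: "first_True (replicate t False) = t"
  by (simp add: first_True_def takeWhile_replicate)

lemma first_True_eqI:
  assumes "t < length xs" "xs ! t" "\<And>s. s < t \<Longrightarrow> \<not> xs ! s"
  shows "first_True xs = t"
  using assms takeWhile_eq_take_P_nth[of t xs Not] by (simp add: first_True_def)

lemma block_strategy_eq:
  "length xs < m * n \<Longrightarrow> block_strategy m n xs = block_guess m (first_True xs)"
  by (simp add: block_strategy_def)

text \<open>Serves both phases: with \<open>s = t\<close> the last premise is vacuous and no hit has
  occurred yet; with \<open>t < s\<close> the first hit is at \<open>t\<close> and its guess is
  repeated.\<close>

lemma block_strategy_feedback:
  assumes "t \<le> s" "s < m * n" "\<And>r. r < t \<Longrightarrow> \<pi> ! r \<noteq> block_guess m r"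
    and "t < s \<Longrightarrow> \<pi> ! t = block_guess m t"
  shows "block_strategy m n (feedback (block_strategy m n) \<pi> s) = block_guess m t"
proof -
  let ?G = "block_strategy m n"
  have rep: "feedback ?G \<pi> r = replicate r False" if "r \<le> t" for r
    using that assms by (intro feedback_eq_replicate_False) (auto simp: block_strategy_eq)
  have "first_True (feedback ?G \<pi> s) = t"
  proof (cases "t = s")
    case False
    have "\<not> feedback ?G \<pi> s ! q" if "q < t" for q
      using that assms(1,2) assms(3)[OF that] by (auto simp: nth_feedback block_strategy_eq rep)
    moreover have "feedback ?G \<pi> s ! t"
      using False assms by (auto simp: nth_feedback block_strategy_eq rep)
    ultimately show ?thesis using False assms(1) by (intro first_True_eqI) auto
  qed (simp add: rep)
  thus ?thesis using assms by (simp add: block_strategy_eq)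
qed

lemma score_block_strategy_first_hit:
  assumes "\<pi> \<in> first_hit m n (block_guess m) t" "t < m * n"
  shows "score (block_strategy m n) \<pi> = 1 + card {p \<in> {t<..<m * n}. \<pi> ! p = block_guess m t}"
proof -
  let ?G = "block_strategy m n"
  have \<pi>: "\<pi> \<in> decks m n" "\<And>r. r < t \<Longrightarrow> \<pi> ! r \<noteq> block_guess m r" "\<pi> ! t = block_guess m t"
    using assms(1) by (auto simp: first_hit_def avoiding_def)
  have before: "?G (feedback ?G \<pi> s) \<noteq> \<pi> ! s" if "s < t" for s
    using block_strategy_feedback[of s s m n \<pi>] that assms(2) \<pi>(2) by fastforce
  have after: "?G (feedback ?G \<pi> s) = block_guess m t" if "t \<le> s" "s < m * n" for s
    using block_strategy_feedback[of t s m n \<pi>] that \<pi> by auto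
  have "{s. s < m * n \<and> ?G (feedback ?G \<pi> s) = \<pi> ! s}
      = insert t {p \<in> {t<..<m * n}. \<pi> ! p = block_guess m t}" (is "?L = ?R")
  proof (intro set_eqI)
    fix s
    consider "s < t" | "s = t" | "t < s" by linarith
    thus "s \<in> ?L \<longleftrightarrow> s \<in> ?R"
      using before[of s] after[of s] \<pi>(3) assms(2) by cases auto
  qed
  thus ?thesis using length_decks[OF \<pi>(1)] by (simp add: score_eq_card)
qed

lemma score_block_strategy_avoiding:
  assumes "\<pi> \<in> avoiding m n (block_guess m) (m * n)"
  shows "score (block_strategy m n) \<pi> = 0"
proof -
  let ?G = "block_strategy m n"
  have \<pi>: "\<pi> \<in> decks m n" "\<And>r. r < m * n \<Longrightarrow> \<pi> ! r \<noteq> block_guess m r"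
    using assms by (auto simp: avoiding_def)
  have "?G (feedback ?G \<pi> s) \<noteq> \<pi> ! s" if "s < m * n" for s
    using block_strategy_feedback[of s s m n \<pi>] that \<pi>(2) by fastforce
  thus ?thesis using length_decks[OF \<pi>(1)] by (auto simp: score_eq_card)
qed

lemma sum_decks_by_first_hit:
  fixes f :: "nat list \<Rightarrow> real"
  shows "(\<Sum>\<pi>\<in>decks m n. f \<pi>)
    = (\<Sum>t<T. \<Sum>\<pi>\<in>first_hit m n g t. f \<pi>) + (\<Sum>\<pi>\<in>avoiding m n g T. f \<pi>)"
proof (induction T)
  case 0
  show ?case by (simp add: avoiding_def)
next
  case (Suc T)
  have "sum f (avoiding m n g T) = sum f (avoiding m n g (Suc T)) + sum f (first_hit m n g T)"
    by (subst avoiding_Suc[symmetric], rule sum.union_disjoint)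
       (simp_all add: avoiding_first_hit_disjoint)
  with Suc show ?case by simp
qed

text \<open>The positions to which a copy of \<open>block_guess m t\<close> can be moved without
  creating a hit before \<open>t\<close>. Leaving out \<open>t\<close> itself protects the hit at
  \<open>t\<close> when a later copy is moved.\<close>

definition free_positions :: "nat \<Rightarrow> nat \<Rightarrow> nat \<Rightarrow> nat set" where
  "free_positions m n t = {q. q < m * n \<and> q \<noteq> t \<and> (q < t \<longrightarrow> block_guess m q \<noteq> block_guess m t)}"

lemma free_positions_subset: "free_positions m n t \<subseteq> {..<m * n}"
  by (auto simp: free_positions_def)

lemma finite_free_positions [simp]: "finite (free_positions m n t)"
  by (rule finite_subset[OF free_positions_subset]) simp

lemma card_free_positions:
  assumes "m > 0"
  shows "m * n - m \<le> card (free_positions m n t)"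
proof -
  \<comment> \<open>\<open>m * (t div m)\<close> is the start of the block containing
    \<open>t\<close>; every position that is not free lies between it and \<open>t\<close>, which
    leaves at most \<open>m\<close> of them.\<close>
  have "{..<m * n} \<subseteq> free_positions m n t \<union> {m * (t div m)..t}"
  proof
    fix q assume q: "q \<in> {..<m * n}"
    have "m * (q div m) \<le> q" by simp
    with q show "q \<in> free_positions m n t \<union> {m * (t div m)..t}"
      by (cases "q div m = t div m") (auto simp: free_positions_def)
  qed
  hence "card {..<m * n} \<le> card (free_positions m n t \<union> {m * (t div m)..t})"
    by (intro card_mono) auto
  also have "\<dots> \<le> card (free_positions m n t) + card {m * (t div m)..t}"
    by (rule card_Un_le)
  also have "card {m * (t div m)..t} = Suc (t mod m)"
    by (simp add: Suc_diff_le minus_mult_div_eq_mod)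
  also have "Suc (t mod m) \<le> m" using assms by (simp add: Suc_le_eq)
  finally show ?thesis by simp
qed

text \<open>The matching card is moved away from \<open>t\<close> to a free position; the card
  arriving at \<open>t\<close> is unconstrained by avoidance before \<open>t\<close>. Hence there
  are no exceptional pairs and no error term.\<close>

lemma card_first_hit_block_le:
  assumes "m > 0" "t < m * n"
  shows "card (first_hit m n (block_guess m) t) * (m * n - m)
    \<le> m * card (avoiding m n (block_guess m) t)"
proof -
  let ?A = "avoiding m n (block_guess m) t"
  have "card {\<pi> \<in> ?A. \<pi> ! t = block_guess m t} * card (free_positions m n t) \<le> m * card ?A"
  proof (rule card_swap_le[where N = "m * n"])
    fix \<pi> q assume *: "\<pi> \<in> ?A" "\<pi> ! t = block_guess m t" "q \<in> free_positions m n t"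
    hence D: "\<pi> \<in> decks m n" "length \<pi> = m * n" by (auto simp: avoiding_decks length_decks)
    with * assms show "swap_nth \<pi> t q \<in> ?A"
      by (auto simp: avoiding_def free_positions_def swap_nth_in_decks nth_swap_nth)
  next
    fix \<pi> assume "\<pi> \<in> ?A"
    thus "card {q \<in> free_positions m n t. \<pi> ! q = block_guess m t} \<le> m"
      using assms free_positions_subset
      by (intro card_positions_subset_decks avoiding_decks block_guess_in_range)
  qed (use assms free_positions_subset length_decks avoiding_decks in auto)
  moreover have "card (first_hit m n (block_guess m) t) * (m * n - m)
      \<le> card (first_hit m n (block_guess m) t) * card (free_positions m n t)"
    using card_free_positions[OF assms(1)] by (intro mult_le_mono2)
  ultimately show ?thesis unfolding first_hit_def by linarith
qed

text \<open>Moving the copy at \<open>p\<close> to a free position keeps the first hit at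
  \<open>t\<close>. The hit itself uses up one of the \<open>m\<close> copies, so at most
  \<open>m - 1\<close> lie at free positions.\<close>

lemma card_first_hit_block_again_le:
  assumes "m > 0" "t < p" "p < m * n"
  shows "card {\<pi> \<in> first_hit m n (block_guess m) t. \<pi> ! p = block_guess m t} * (m * n - m)
    \<le> (m - 1) * card (first_hit m n (block_guess m) t)"
proof -
  let ?H = "first_hit m n (block_guess m) t" and ?i = "block_guess m t"
  let ?Q = "free_positions m n t"
  have H: "\<pi> \<in> decks m n" "length \<pi> = m * n" if "\<pi> \<in> ?H" for \<pi>
    using that by (auto simp: first_hit_def avoiding_decks length_decks)
  have "card {\<pi> \<in> ?H. \<pi> ! p = ?i} * card ?Q \<le> (m - 1) * card ?H"
  proof (rule card_swap_le[where N = "m * n"])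
    fix \<pi> q assume *: "\<pi> \<in> ?H" "\<pi> ! p = ?i" "q \<in> ?Q"
    thus "swap_nth \<pi> p q \<in> ?H" using H[OF *(1)] assms
      by (auto simp: first_hit_def avoiding_def free_positions_def swap_nth_in_decks nth_swap_nth)
  next
    fix \<pi> assume \<pi>: "\<pi> \<in> ?H"
    have "card (insert t {q \<in> ?Q. \<pi> ! q = ?i}) \<le> card {q. q < m * n \<and> \<pi> ! q = ?i}"
      using \<pi> assms by (intro card_mono) (auto simp: free_positions_def first_hit_def)
    also have "\<dots> = m"
      using H[OF \<pi>] block_guess_in_range[of t m n] assms by (intro card_positions_decks) auto
    finally show "card {q \<in> ?Q. \<pi> ! q = ?i} \<le> m - 1"
      by (subst (asm) card_insert_disjoint) (auto simp: free_positions_def)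
  qed (use assms free_positions_subset H in auto)
  moreover have "card {\<pi> \<in> ?H. \<pi> ! p = ?i} * (m * n - m) \<le> card {\<pi> \<in> ?H. \<pi> ! p = ?i} * card ?Q"
    using card_free_positions[OF assms(1)] by (intro mult_le_mono2)
  ultimately show ?thesis by linarith
qed

text \<open>By \<open>card_first_hit_block_le\<close>, at most a fraction
  \<open>m / (m * n - m) = 1 / (n - 1)\<close> of the avoiding decks is lost in each round.
  \<open>n \<ge> 2\<close> makes the remaining factor nonnegative, so the bounds multiply.\<close>

lemma card_avoiding_block_ge:
  assumes "m > 0" "n \<ge> 2" "t \<le> m * n"
  shows "(1 - 1 / (real n - 1)) ^ t
    \<le> card (avoiding m n (block_guess m) t) / card (decks m n)"
  using assms(3)
proof (induction t)
  case 0
  show ?case by (simp add: avoiding_def decks_nonempty finite_decks)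
next
  case (Suc t)
  define A where "A = real (card (avoiding m n (block_guess m) t))"
  define A' where "A' = real (card (avoiding m n (block_guess m) (Suc t)))"
  define H where "H = real (card (first_hit m n (block_guess m) t))"
  have "A' + H = A"
    unfolding A_def A'_def H_def using card_avoiding_Suc[of m n "block_guess m" t] by linarith
  have "real (card (first_hit m n (block_guess m) t) * (m * n - m))
    \<le> real (m * card (avoiding m n (block_guess m) t))"
    using card_first_hit_block_le[of m t n] Suc.prems assms(1) by (simp only: of_nat_le_iff)
  hence "m * (H * (real n - 1)) \<le> m * A"
    using assms by (simp add: A_def H_def of_nat_diff algebra_simps)
  hence "H * (real n - 1) \<le> A" using assms by simp
  hence "H \<le> A / (real n - 1)" using assms by (simp add: pos_le_divide_eq)
  hence "(1 - 1 / (real n - 1)) * A \<le> A'" using \<open>A' + H = A\<close> by (simp add: algebra_simps)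
  moreover have "(1 - 1 / (real n - 1)) * (1 - 1 / (real n - 1)) ^ t
      \<le> (1 - 1 / (real n - 1)) * (A / card (decks m n))"
    using Suc assms by (intro mult_left_mono) (auto simp: A_def)
  ultimately show ?case
    unfolding A'_def[symmetric] power_Suc
    by (smt (verit) divide_right_mono of_nat_0_le_iff times_divide_eq_right)
qed

text \<open>Linearity of expectation: the hit counts 1, and each of the \<open>m * n - 1 - t\<close>
  later positions repeats the letter with conditional probability at most \<kappa>.\<close>

lemma sum_score_first_hit_le:
  assumes "m > 0" "n \<ge> 2" "t < m * n"
  shows "(\<Sum>\<pi>\<in>first_hit m n (block_guess m) t. real (score (block_strategy m n) \<pi>))
    \<le> card (first_hit m n (block_guess m) t)
      * (1 + (real (m * n) - 1 - t) * ((real m - 1) / (m * (real n - 1))))"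
proof -
  let ?H = "first_hit m n (block_guess m) t" and ?i = "block_guess m t"
  define \<kappa> where "\<kappa> = (real m - 1) / (m * (real n - 1))"
  have again: "real (card {\<pi> \<in> ?H. \<pi> ! p = ?i}) \<le> card ?H * \<kappa>" if "p \<in> {t<..<m * n}" for p
  proof -
    have "real (card {\<pi> \<in> ?H. \<pi> ! p = ?i} * (m * n - m)) \<le> real ((m - 1) * card ?H)"
      using card_first_hit_block_again_le[of m t p n] that assms(1) by (simp only: of_nat_le_iff) auto
    hence "card {\<pi> \<in> ?H. \<pi> ! p = ?i} * (m * (real n - 1)) \<le> (real m - 1) * card ?H"
      using assms by (simp add: of_nat_diff algebra_simps)
    thus ?thesis using assms by (simp add: \<kappa>_def pos_le_divide_eq mult.commute)
  qed
  have "(\<Sum>\<pi>\<in>?H. real (score (block_strategy m n) \<pi>))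
      = (\<Sum>\<pi>\<in>?H. 1 + (\<Sum>p\<in>{t<..<m * n}. if \<pi> ! p = ?i then 1 else (0::real)))"
    using assms(3) by (intro sum.cong refl)
      (simp add: score_block_strategy_first_hit sum.inter_filter[symmetric])
  also have "\<dots> = card ?H + (\<Sum>p\<in>{t<..<m * n}. \<Sum>\<pi>\<in>?H. if \<pi> ! p = ?i then 1 else (0::real))"
    by (subst sum.swap) (simp add: sum.distrib)
  also have "\<dots> = card ?H + (\<Sum>p\<in>{t<..<m * n}. real (card {\<pi> \<in> ?H. \<pi> ! p = ?i}))"
    by (simp add: sum.inter_filter[symmetric])
  also have "\<dots> \<le> card ?H + (\<Sum>p\<in>{t<..<m * n}. card ?H * \<kappa>)"
    using again by (intro add_left_mono sum_mono)
  also have "\<dots> = card ?H * (1 + (real (m * n) - 1 - t) * \<kappa>)"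
    using assms(3) by (simp add: of_nat_diff algebra_simps)
  finally show ?thesis by (simp only: \<kappa>_def)
qed

text \<open>Summation by parts. For \<kappa> \<ge> 0 all values after \<open>a 0\<close> enter the
  right side with nonpositive sign, so lower bounds on them give an upper bound on the sum.\<close>

lemma sum_differences_weighted:
  fixes a :: "nat \<Rightarrow> real"
  shows "(\<Sum>t<N. (a t - a (Suc t)) * (1 + (real N - 1 - t) * \<kappa>))
    = a 0 - a N + \<kappa> * (\<Sum>t<N. a 0 - a t)"
proof (induction N)
  case (Suc N)
  \<comment> \<open>Raising \<open>N\<close> by one lifts every weight by \<kappa>, and these
    increments telescope.\<close>
  have "(\<Sum>t<N. (a t - a (Suc t)) * (1 + (real (Suc N) - 1 - t) * \<kappa>))
      = (\<Sum>t<N. (a t - a (Suc t)) * (1 + (real N - 1 - t) * \<kappa>) + \<kappa> * (a t - a (Suc t)))"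
    by (intro sum.cong refl) (simp add: algebra_simps)
  also have "\<dots> = (\<Sum>t<N. (a t - a (Suc t)) * (1 + (real N - 1 - t) * \<kappa>)) + \<kappa> * (a 0 - a N)"
    by (simp add: sum.distrib sum_distrib_left[symmetric] sum_lessThan_telescope')
  finally show ?case using Suc.IH by (simp add: algebra_simps)
qed simp

lemma expected_score_block_strategy_le:
  assumes "m > 0" "n \<ge> 2"
  defines "r \<equiv> 1 - 1 / (real n - 1)"
  shows "expected_score m n (block_strategy m n)
    \<le> 1 - r ^ (m * n) + (real m - 1) * n / (real n - 1) - (real m - 1) / m * (1 - r ^ (m * n))"
proof -
  let ?N = "m * n" and ?H = "first_hit m n (block_guess m)" and ?A = "avoiding m n (block_guess m)"
  define D where "D = real (card (decks m n))"
  \<comment> \<open>\<open>a t\<close> is the probability of no hit before \<open>t\<close>, so its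
    decrements are the probabilities of a first hit at \<open>t\<close>.\<close>
  define a where "a t = card (?A t) / D" for t
  define \<kappa> where "\<kappa> = (real m - 1) / (m * (real n - 1))"
  have D: "D > 0" by (simp add: D_def card_gt_0_iff finite_decks decks_nonempty)
  have \<kappa>: "\<kappa> \<ge> 0" using assms by (auto simp: \<kappa>_def)
  have a0: "a 0 = 1" using D by (simp add: a_def avoiding_def D_def)
  have a: "r ^ t \<le> a t" if "t \<le> ?N" for t
    using card_avoiding_block_ge[OF assms(1,2) that] by (simp add: a_def D_def r_def)
  have H: "card (?H t) / D = a t - a (Suc t)" for t
  proof -
    have "real (card (?H t)) = real (card (?A t)) - card (?A (Suc t))"
      using card_avoiding_Suc[of m n "block_guess m" t] by linarith
    thus ?thesis by (simp add: a_def diff_divide_distrib)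
  qed
  have "(\<Sum>\<pi>\<in>decks m n. real (score (block_strategy m n) \<pi>))
      = (\<Sum>t<?N. \<Sum>\<pi>\<in>?H t. real (score (block_strategy m n) \<pi>))"
    by (subst sum_decks_by_first_hit[where T = ?N and g = "block_guess m"])
       (simp add: score_block_strategy_avoiding)
  also have "\<dots> \<le> (\<Sum>t<?N. card (?H t) * (1 + (real ?N - 1 - t) * \<kappa>))"
    using sum_score_first_hit_le[OF assms(1,2)] by (intro sum_mono) (simp add: \<kappa>_def)
  finally have "expected_score m n (block_strategy m n)
      \<le> (\<Sum>t<?N. card (?H t) * (1 + (real ?N - 1 - t) * \<kappa>)) / D"
    unfolding expected_score_eq_sum D_def by (intro divide_right_mono) auto
  also have "\<dots> = (\<Sum>t<?N. (a t - a (Suc t)) * (1 + (real ?N - 1 - t) * \<kappa>))"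
    by (simp add: sum_divide_distrib flip: H)
  also have "\<dots> = 1 - a ?N + \<kappa> * (\<Sum>t<?N. 1 - a t)"
    using sum_differences_weighted[of a ?N \<kappa>] a0 by simp
  also have "\<dots> \<le> 1 - r ^ ?N + \<kappa> * (\<Sum>t<?N. 1 - r ^ t)"
    using a \<kappa> by (intro add_mono diff_mono mult_left_mono sum_mono) auto
  also have "(\<Sum>t<?N. 1 - r ^ t) = ?N - (real n - 1) * (1 - r ^ ?N)"
  proof -
    \<comment> \<open>Geometric sum, with \<open>1 - r = 1 / (n - 1)\<close>.\<close>
    have "r \<noteq> 1" using assms by (simp add: r_def)
    hence "(\<Sum>t<?N. r ^ t) = (1 - r ^ ?N) / (1 - r)" by (simp add: sum_gp_strict)
    also have "\<dots> = (real n - 1) * (1 - r ^ ?N)" by (simp add: r_def)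
    finally show ?thesis by (simp add: sum_subtractf)
  qed
  also have "\<kappa> * (?N - (real n - 1) * (1 - r ^ ?N))
      = (real m - 1) * n / (real n - 1) - (real m - 1) / m * (1 - r ^ ?N)"
  proof -
    have "\<kappa> * ?N = (real m - 1) * n / (real n - 1)" using assms(1) by (simp add: \<kappa>_def)
    moreover have "\<kappa> * (real n - 1) = (real m - 1) / m" using assms(2) by (simp add: \<kappa>_def)
    ultimately show ?thesis by (simp only: right_diff_distrib mult.assoc[symmetric])
  qed
  finally show ?thesis by (simp only: add_diff_eq)
qed

section \<open>Asymptotics\<close>

lemma one_minus_inverse_power_tendsto:
  "(\<lambda>n. (1 - 1 / real n) ^ (m * n)) \<longlonglongrightarrow> exp (- real m)"
proof -
  have "(\<lambda>n. ((1 + (-1) / real n) ^ n) ^ m) \<longlonglongrightarrow> exp (-1) ^ m"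
    by (intro tendsto_power tendsto_exp_limit_sequentially)
  thus ?thesis by (simp add: power_mult[symmetric] mult.commute exp_of_nat_mult[symmetric])
qed

lemma one_minus_inverse_pred_power_tendsto:
  "(\<lambda>n. (1 - 1 / (real n - 1)) ^ (m * n)) \<longlonglongrightarrow> exp (- real m)"
proof -
  have "(\<lambda>n. (1 - 1 / (real n - 1)) ^ n) \<longlonglongrightarrow> exp (-1)"
    by real_asymp
  hence "(\<lambda>n. ((1 - 1 / (real n - 1)) ^ n) ^ m) \<longlonglongrightarrow> exp (-1) ^ m"
    by (rule tendsto_power)
  thus ?thesis by (simp add: power_mult[symmetric] mult.commute exp_of_nat_mult[symmetric])
qed

theorem theorem3:
  fixes m :: nat
  assumes "m \<ge> 1"
  shows "\<exists>\<epsilon> \<delta> :: nat \<Rightarrow> real. \<epsilon> \<longlonglongrightarrow> 0 \<and> \<delta> \<longlonglongrightarrow> 0 \<and>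
    (\<forall>\<^sub>F n in sequentially.
       1 - exp (- real m) - \<epsilon> n \<le> misere_value m n \<and>
       misere_value m n \<le> real m - 1 + 1 / real m - exp (- real m) / real m + \<delta> n)"
proof -
  define L where "L n = (1 - 1 / real n) ^ (m * n) + real m ^ 2 / (real (m * n) - 1)" for n
  define r where "r n = (1 - 1 / (real n - 1)) ^ (m * n)" for n
  define U where "U n = 1 - r n + (real m - 1) * n / (real n - 1) - (real m - 1) / m * (1 - r n)" for n
  define u where "u = real m - 1 + 1 / real m - exp (- real m) / real m"
  have "(\<lambda>n. real m ^ 2 / (real m * real n - 1)) \<longlonglongrightarrow> 0"
    using assms by real_asymp
  hence "L \<longlonglongrightarrow> exp (- real m) + 0"
    unfolding L_def of_nat_mult by (intro tendsto_add one_minus_inverse_power_tendsto)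
  hence "(\<lambda>n. L n - exp (- real m)) \<longlonglongrightarrow> 0"
    by (simp add: LIM_zero_iff)
  moreover have "(\<lambda>n. U n - u) \<longlonglongrightarrow> 0"
  proof -
    have "(\<lambda>n. real n / (real n - 1)) \<longlonglongrightarrow> 1" by real_asymp
    hence "(\<lambda>n. (real m - 1) * (real n / (real n - 1))) \<longlonglongrightarrow> (real m - 1) * 1"
      by (intro tendsto_intros)
    hence "U \<longlonglongrightarrow> 1 - exp (- real m) + (real m - 1) * 1 - (real m - 1) / m * (1 - exp (- real m))"
      unfolding U_def r_def times_divide_eq_right
      by (intro tendsto_intros one_minus_inverse_pred_power_tendsto)
    \<comment> \<open>The terms with \<open>1 - exp (- m)\<close> combine to
      \<open>(1 - exp (- m)) / m\<close>, because \<open>1 - (m - 1) / m = 1 / m\<close>.\<close>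
    also have "1 - exp (- real m) + (real m - 1) * 1 - (real m - 1) / m * (1 - exp (- real m)) = u"
      using assms by (simp add: u_def field_simps)
    finally show ?thesis by (simp add: LIM_zero_iff)
  qed
  moreover have "\<forall>\<^sub>F n in sequentially.
       1 - exp (- real m) - (L n - exp (- real m)) \<le> misere_value m n \<and>
       misere_value m n \<le> u + (U n - u)"
  proof (rule eventually_sequentiallyI[of 2], intro conjI)
    fix n :: nat assume n: "2 \<le> n"
    have "1 * 2 \<le> m * n" using assms n by (intro mult_le_mono)
    hence N: "m * n > 1" by simp
    \<comment> \<open>The minimum is attained by some strategy, to which the lower bound valid for
      every strategy applies.\<close>
    have "misere_value m n \<in> expected_score m n ` strategies m n"
      unfolding misere_value_def using n
      by (intro Min_in) (auto simp: finite_strategies strategies_nonempty)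
    thus "1 - exp (- real m) - (L n - exp (- real m)) \<le> misere_value m n"
      using expected_score_ge[OF _ N] by (force simp only: L_def diff_diff_eq2 diff_add_cancel)
    have "misere_value m n \<le> expected_score m n (block_strategy m n)"
      unfolding misere_value_def
      by (intro Min_le) (auto simp: finite_strategies block_strategy_in_strategies)
    also have "\<dots> \<le> U n"
      using expected_score_block_strategy_le[of m n] assms n by (simp add: U_def r_def)
    finally show "misere_value m n \<le> u + (U n - u)" by simp
  qed
  ultimately show ?thesis
    unfolding u_def
    by (intro exI[of _ "\<lambda>n. L n - exp (- real m)"] exI[of _ "\<lambda>n. U n - u"]) (simp add: u_def)
qed

end
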